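(* Let $G$ be a nilpotent-by-abelian group generated by a finite Engel set. Then $G$ is nilpotent.
   Context: Commutator notation: $[x,y]=x^{-1}y^{-1}xy$, and $[x,\,_0 y]=x$, $[x,\,_{n+1}y]=[[x,\,_n y],y]$ for $n\ge 0$. A subset $S$ of a group $G$ is called an Engel set if, for all $x,y\in S$, there is a non-negative integer $n=n(x,y)$ such that $[x,\,_n y]=1$. A group $G$ is nilpotent-by-abelian if it has a normal nilpotent subgroup $N$ such that $G/N$ is abelian. *)

theory Defs
  imports "HOL-Algebra.Algebra"
begin

definition commutator :: "('a, 'b) monoid_scheme \<Rightarrow> 'a \<Rightarrow> 'a \<Rightarrow> 'a" where
  "commutator G x y = inv\<^bsub>G\<^esub> x \<otimes>\<^bsub>G\<^esub> inv\<^bsub>G\<^esub> y \<otimes>\<^bsub>G\<^esub> x \<otimes>\<^bsub>G\<^esub> y"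

text \<open>The left-normed commutator $[x,\,_n y]$, with $n$ entries $y$.\<close>

primrec iter_commutator :: "('a, 'b) monoid_scheme \<Rightarrow> 'a \<Rightarrow> nat \<Rightarrow> 'a \<Rightarrow> 'a" where
  "iter_commutator G x 0 y = x"
| "iter_commutator G x (Suc n) y = commutator G (iter_commutator G x n y) y"

text \<open>Since $x$ and $y$ range independently over $S$, both $[x,\,_n y]$ and $[y,\,_m x]$ must be
  trivial for suitable $n$, $m$.\<close>

definition engel_set :: "('a, 'b) monoid_scheme \<Rightarrow> 'a set \<Rightarrow> bool" where
  "engel_set G S \<longleftrightarrow>
     S \<subseteq> carrier G \<and> (\<forall>x\<in>S. \<forall>y\<in>S. \<exists>n. iter_commutator G x n y = \<one>\<^bsub>G\<^esub>)"

text \<open>Indexed from 0, so that \<open>lower_central G n\<close> is $\gamma_{n+1}(G)$.\<close>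

primrec lower_central :: "('a, 'b) monoid_scheme \<Rightarrow> nat \<Rightarrow> 'a set" where
  "lower_central G 0 = carrier G"
| "lower_central G (Suc n) =
     generate G {commutator G x y | x y. x \<in> lower_central G n \<and> y \<in> carrier G}"

definition nilpotent :: "('a, 'b) monoid_scheme \<Rightarrow> bool" where
  "nilpotent G \<longleftrightarrow> (\<exists>n. lower_central G n = {\<one>\<^bsub>G\<^esub>})"

definition nilpotent_by_abelian :: "('a, 'b) monoid_scheme \<Rightarrow> bool" where
  "nilpotent_by_abelian G \<longleftrightarrow>
     (\<exists>N. N \<lhd> G \<and> nilpotent (G\<lparr>carrier := N\<rparr>) \<and> comm_group (G Mod N))"

end

theory Submission
  imports Defs
begin

text \<open>Let $N$ be a nilpotent normal subgroup of $G$ with $G/N$ abelian. The proof first shows that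
  $G/[N,N]$ is nilpotent and then lifts this to $G$.

  In $Q = G/[N,N]$ the image $A$ of $N$ is abelian and contains all commutators. The maps
  $a \mapsto [a,g]$ are therefore pairwise commuting endomorphisms of $A$. Let $n$ serve as an Engel
  exponent for all pairs of generators. If $x$, $y$, $z$ are generators, the Jacobi identity
  $[x,y,z] = [x,[y,z]]\,[x,z,y]$ shows that $[\cdot,z]^{n+1}$ kills $[x,y]$, because $[\cdot,z]^n$
  kills $[x,z]$ and $[y,z]$. The derived subgroup $Q'$ is the normal closure of the elements $[x,y]$,
  so $[\cdot,z]^{n+1}$ kills all of $Q'$ (\<open>engel_on_derived\<close>). As there are finitely many
  generators, every sufficiently long product of the maps $[\cdot,z]$ repeats one of them more than
  $n$ times and so vanishes on $Q'$ (\<open>foldl_commutator_long_word\<close>). Vanishing of long words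
  in the generators forces vanishing of long words in arbitrary group elements
  (\<open>foldl_commutator_generators\<close>), which is nilpotency of $Q$.

  For the lifting step, nilpotency of $G/[N,N]$ implies that a long commutator $[N,G,\dots,G]$ lies in
  $[N,N]$. By the Leibniz rule for commutator subgroups
  (\<open>iter_commutator_subgroup_leibniz\<close>), a consequence of the three subgroups lemma, the same
  holds on every factor of the lower central series of $N$; since this series reaches $1$, so does the
  lower central series of $G$ (\<open>nilpotent_if_quotient_by_derived_nilpotent\<close>).\<close>

section \<open>Commutator identities\<close>

lemma iter_commutator_eq_foldl:
  "iter_commutator G x n y = foldl (commutator G) x (replicate n y)"
  by (induction n) (simp_all flip: replicate_append_same)

lemma iter_commutator_Suc_left:
  "iter_commutator G x (Suc n) y = iter_commutator G (commutator G x y) n y"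
  by (induction n) simp_all

context group
begin

lemma commutator_closed [simp, intro]:
  "\<lbrakk>x \<in> carrier G; y \<in> carrier G\<rbrakk> \<Longrightarrow> commutator G x y \<in> carrier G"
  by (simp add: commutator_def)

lemma inv_cancel:
  assumes "x \<in> carrier G" "y \<in> carrier G"
  shows "x \<otimes> (inv x \<otimes> y) = y" "inv x \<otimes> (x \<otimes> y) = y"
  using assms by (simp_all flip: m_assoc)

text \<open>Rewriting with these equations and the standard simplification rules computes reduced words, so it
  decides the identities that hold in free groups.\<close>

lemmas group_word = m_assoc inv_mult_group inv_cancel

lemma inv_commutator:
  "\<lbrakk>x \<in> carrier G; y \<in> carrier G\<rbrakk> \<Longrightarrow> inv (commutator G x y) = commutator G y x"
  by (simp add: commutator_def group_word)

lemma commutator_eq_one_iff: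
  assumes "x \<in> carrier G" "y \<in> carrier G"
  shows "commutator G x y = \<one> \<longleftrightarrow> x \<otimes> y = y \<otimes> x"
proof -
  have "x \<otimes> y = y \<otimes> x \<otimes> commutator G x y"
    using assms by (simp add: commutator_def group_word)
  then show ?thesis
    using assms by simp
qed

lemma commutator_one [simp]: "x \<in> carrier G \<Longrightarrow> commutator G \<one> x = \<one>"
  by (simp add: commutator_eq_one_iff)

lemma commutator_mult_left:
  "\<lbrakk>x \<in> carrier G; y \<in> carrier G; z \<in> carrier G\<rbrakk> \<Longrightarrow>
    commutator G (x \<otimes> y) z = inv y \<otimes> commutator G x z \<otimes> y \<otimes> commutator G y z"
  by (simp add: commutator_def group_word)

lemma commutator_inv_left:
  "\<lbrakk>x \<in> carrier G; z \<in> carrier G\<rbrakk> \<Longrightarrow>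
    commutator G (inv x) z = x \<otimes> inv (commutator G x z) \<otimes> inv x"
  by (simp add: commutator_def group_word)

lemma iter_commutator_le:
  assumes "iter_commutator G x n y = \<one>" "n \<le> m" "y \<in> carrier G"
  shows "iter_commutator G x m y = \<one>"
  using assms(2,1,3) by (induction m rule: dec_induct) auto

text \<open>Conjugation by $z$ sends $a$ to $au$ and $b$ to $bv$, hence $[a,b]$ to $[au,bv]$; expanding
  the latter commutator expresses $[a,b,z]$ through commutators that involve $u = [a,z]$ or
  $v = [b,z]$. This is a form of the Jacobi identity in which no inverses
  occur inside the commutators, and it yields the three subgroups lemma as well as
  the Jacobi identity of metabelian groups.\<close>

lemma commutator_jacobi:
  fixes a b z
  defines "c \<equiv> commutator G a b" and "u \<equiv> commutator G a z" and "v \<equiv> commutator G b z"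
  assumes "a \<in> carrier G" "b \<in> carrier G" "z \<in> carrier G"
  shows "commutator G c z =
    inv c \<otimes> (inv u \<otimes> commutator G a v \<otimes> u) \<otimes> c \<otimes> commutator G c u
      \<otimes> (inv u \<otimes> commutator G c v \<otimes> u) \<otimes> commutator G u v \<otimes> (inv v \<otimes> commutator G u b \<otimes> v)"
  using assms(4-) unfolding c_def u_def v_def commutator_def
  by (simp add: group_word)

section \<open>Commutator subgroups of normal subgroups\<close>

lemma commutator_in_normal:
  assumes "P \<lhd> G" "x \<in> carrier G" "y \<in> carrier G" "x \<in> P \<or> y \<in> P"
  shows "commutator G x y \<in> P"
proof -
  interpret P: normal P G by fact
  have *: "commutator G x y \<in> P" if "x \<in> P" "y \<in> carrier G" for x y
    using that P.inv_op_closed1[of y x] P.mem_carrier[of x]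
    by (simp add: commutator_def m_assoc)
  have "inv (commutator G y x) \<in> P" if "y \<in> P"
    using *[of y x] that assms by blast
  with * assms show ?thesis
    by (auto simp: inv_commutator)
qed

text \<open>For $P$ normal in $G$, this is the preimage of the centraliser of the image of $V$ in
  $G/P$. Working with it keeps arguments modulo $P$ inside $G$.\<close>

definition centralizer_mod :: "'a set \<Rightarrow> 'a set \<Rightarrow> 'a set" where
  "centralizer_mod P V = {x \<in> carrier G. \<forall>y\<in>V. commutator G x y \<in> P}"

lemma subgroup_centralizer_mod:
  assumes "P \<lhd> G" "V \<subseteq> carrier G"
  shows "subgroup (centralizer_mod P V) G"
proof -
  interpret P: normal P G by fact
  show ?thesis
  proof (rule subgroupI)
    show "centralizer_mod P V \<noteq> {}"
      using assms by (auto simp: centralizer_mod_def intro!: exI[of _ \<one>])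
  qed (use assms(2) in \<open>auto simp: centralizer_mod_def commutator_mult_left commutator_inv_left
        subset_iff intro!: P.m_closed P.inv_op_closed1 P.inv_op_closed2\<close>)
qed

lemma normal_centralizer_mod_carrier:
  assumes "P \<lhd> G"
  shows "centralizer_mod P (carrier G) \<lhd> G"
proof (rule normal_invI[OF subgroup_centralizer_mod[OF assms]])
  interpret P: normal P G by fact
  fix g x assume g: "g \<in> carrier G" and x: "x \<in> centralizer_mod P (carrier G)"
  have "commutator G (g \<otimes> x \<otimes> inv g) y \<in> P" if y: "y \<in> carrier G" for y
  proof -
    have "commutator G (g \<otimes> x \<otimes> inv g) y = g \<otimes> commutator G x (inv g \<otimes> y \<otimes> g) \<otimes> inv g"
      using g x y by (simp add: centralizer_mod_def commutator_def group_word)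
    also have "\<dots> \<in> P"
      using g x y by (intro P.inv_op_closed2) (auto simp: centralizer_mod_def)
    finally show ?thesis .
  qed
  then show "g \<otimes> x \<otimes> inv g \<in> centralizer_mod P (carrier G)"
    using g x by (simp add: centralizer_mod_def)
qed simp

text \<open>Modulo $P$, elements that commute with a set commute with the subgroup it generates; this
  is used once in each argument.\<close>

lemma commutator_generate_in_normal:
  assumes P: "P \<lhd> G" and U: "U \<subseteq> carrier G" and V: "V \<subseteq> carrier G"
    and UV: "\<And>x y. \<lbrakk>x \<in> U; y \<in> V\<rbrakk> \<Longrightarrow> commutator G x y \<in> P"
    and x: "x \<in> generate G U" and y: "y \<in> generate G V"
  shows "commutator G x y \<in> P"
proof -
  interpret P: normal P G by fact
  have swap: "commutator G b a \<in> P"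
    if "commutator G a b \<in> P" "a \<in> carrier G" "b \<in> carrier G" for a b
    using P.m_inv_closed[OF that(1)] that by (simp add: inv_commutator)
  have "generate G U \<subseteq> centralizer_mod P V"
    using U UV by (intro generate_subgroup_incl subgroup_centralizer_mod P V)
      (auto simp: centralizer_mod_def)
  with x have x': "x \<in> carrier G" "\<forall>b\<in>V. commutator G x b \<in> P"
    by (auto simp: centralizer_mod_def)
  then have "generate G V \<subseteq> centralizer_mod P {x}"
    using V by (intro generate_subgroup_incl subgroup_centralizer_mod P)
      (auto simp: centralizer_mod_def intro: swap)
  with y x' show ?thesis
    by (auto simp: centralizer_mod_def intro: swap)
qed

lemma commutator_trivial_if_generators:
  assumes S: "S \<subseteq> carrier G" "generate G S = carrier G" and z: "z \<in> carrier G"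
    and triv: "\<And>s. s \<in> S \<Longrightarrow> commutator G z s = \<one>" and g: "g \<in> carrier G"
  shows "commutator G z g = \<one>"
  using commutator_generate_in_normal[OF one_is_normal, of "{z}" S z g] assms
  by (auto intro: generate.incl)

lemma subgroup_normal_if_commutator_closed:
  assumes "subgroup E G" and E: "\<And>x g. \<lbrakk>x \<in> E; g \<in> carrier G\<rbrakk> \<Longrightarrow> commutator G x g \<in> E"
  shows "E \<lhd> G"
proof (rule normal_invI[OF assms(1)])
  fix g x assume g: "g \<in> carrier G" and x: "x \<in> E"
  have "g \<otimes> x \<otimes> inv g = x \<otimes> commutator G x (inv g)"
    using g x subgroup.mem_carrier[OF assms(1)] by (simp add: commutator_def group_word)
  with g x show "g \<otimes> x \<otimes> inv g \<in> E"
    using assms by (simp add: subgroup.m_closed)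
qed

end

definition commutator_subgroup :: "('a, 'b) monoid_scheme \<Rightarrow> 'a set \<Rightarrow> 'a set \<Rightarrow> 'a set" where
  "commutator_subgroup G A B = generate G {commutator G a b | a b. a \<in> A \<and> b \<in> B}"

primrec iter_commutator_subgroup ::
    "('a, 'b) monoid_scheme \<Rightarrow> 'a set \<Rightarrow> nat \<Rightarrow> 'a set \<Rightarrow> 'a set" where
  "iter_commutator_subgroup G A 0 B = A"
| "iter_commutator_subgroup G A (Suc n) B =
     commutator_subgroup G (iter_commutator_subgroup G A n B) B"

lemma lower_central_eq_iter_commutator_subgroup:
  "lower_central G n = iter_commutator_subgroup G (carrier G) n (carrier G)"
  by (induction n) (simp_all add: commutator_subgroup_def)

lemma iter_commutator_subgroup_add:
  "iter_commutator_subgroup G A (m + n) B =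
    iter_commutator_subgroup G (iter_commutator_subgroup G A m B) n B"
  by (induction n) simp_all

context group
begin

lemma commutator_subgroup_subset_iff:
  assumes "subgroup P G"
  shows "commutator_subgroup G A B \<subseteq> P \<longleftrightarrow> (\<forall>a\<in>A. \<forall>b\<in>B. commutator G a b \<in> P)"
proof
  assume "commutator_subgroup G A B \<subseteq> P"
  then show "\<forall>a\<in>A. \<forall>b\<in>B. commutator G a b \<in> P"
    by (auto simp: commutator_subgroup_def intro: generate.incl)
next
  assume "\<forall>a\<in>A. \<forall>b\<in>B. commutator G a b \<in> P"
  then show "commutator_subgroup G A B \<subseteq> P"
    unfolding commutator_subgroup_def by (intro generate_subgroup_incl assms) auto
qed

lemma commutator_in_commutator_subgroup:
  "\<lbrakk>a \<in> A; b \<in> B\<rbrakk> \<Longrightarrow> commutator G a b \<in> commutator_subgroup G A B"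
  by (auto simp: commutator_subgroup_def intro: generate.incl)

lemma commutator_subgroup_mono:
  "\<lbrakk>A \<subseteq> A'; B \<subseteq> B'\<rbrakk> \<Longrightarrow> commutator_subgroup G A B \<subseteq> commutator_subgroup G A' B'"
  unfolding commutator_subgroup_def by (intro mono_generate) auto

lemma commutator_subgroup_normal:
  assumes "A \<lhd> G" "B \<lhd> G"
  shows "commutator_subgroup G A B \<lhd> G"
  unfolding commutator_subgroup_def
proof (rule normal_generateI)
  interpret A: normal A G by fact
  interpret B: normal B G by fact
  show "{commutator G a b |a b. a \<in> A \<and> b \<in> B} \<subseteq> carrier G"
    by auto
  fix h g assume "h \<in> {commutator G a b |a b. a \<in> A \<and> b \<in> B}" and g: "g \<in> carrier G"
  then obtain a b where ab: "a \<in> A" "b \<in> B" "h = commutator G a b"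
    by auto
  then have "g \<otimes> h \<otimes> inv g = commutator G (g \<otimes> a \<otimes> inv g) (g \<otimes> b \<otimes> inv g)"
    using g by (simp add: commutator_def group_word)
  with ab g show "g \<otimes> h \<otimes> inv g \<in> {commutator G a b |a b. a \<in> A \<and> b \<in> B}"
    using A.inv_op_closed2 B.inv_op_closed2 by blast
qed

lemma carrier_normal: "carrier G \<lhd> G"
  by (rule normal_invI[OF subgroup_self]) simp

lemma normal_subset_carrier: "A \<lhd> G \<Longrightarrow> A \<subseteq> carrier G"
  by (simp add: normal_imp_subgroup subgroup.subset)

lemma commutator_subgroup_subset_normal:
  assumes "A \<lhd> G" "B \<subseteq> carrier G"
  shows "commutator_subgroup G A B \<subseteq> A"
  unfolding commutator_subgroup_subset_iff[OF normal_imp_subgroup[OF assms(1)]]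
  using assms normal_subset_carrier[OF assms(1)] by (auto intro!: commutator_in_normal)

lemma commutator_subgroup_commute:
  assumes "A \<subseteq> carrier G" "B \<subseteq> carrier G"
  shows "commutator_subgroup G A B = commutator_subgroup G B A"
proof -
  have *: "commutator_subgroup G A B \<subseteq> commutator_subgroup G B A"
    if "A \<subseteq> carrier G" "B \<subseteq> carrier G" for A B
  proof -
    have sub: "subgroup (commutator_subgroup G B A) G"
      unfolding commutator_subgroup_def using that by (intro generate_is_subgroup) auto
    have "commutator G a b \<in> commutator_subgroup G B A" if "a \<in> A" "b \<in> B" for a b
      using subgroup.m_inv_closed[OF sub commutator_in_commutator_subgroup[OF that(2,1)]]
        that \<open>A \<subseteq> carrier G\<close> \<open>B \<subseteq> carrier G\<close>
      by (simp add: inv_commutator subset_iff)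
    then show ?thesis
      by (simp add: commutator_subgroup_subset_iff[OF sub])
  qed
  from *[of A B] *[of B A] assms show ?thesis by blast
qed

lemma iter_commutator_subgroup_normal:
  assumes "A \<lhd> G" "B \<lhd> G"
  shows "iter_commutator_subgroup G A n B \<lhd> G"
  by (induction n) (simp_all add: assms commutator_subgroup_normal)

lemma iter_commutator_subgroup_mono:
  assumes "A \<subseteq> A'"
  shows "iter_commutator_subgroup G A n B \<subseteq> iter_commutator_subgroup G A' n B"
  by (induction n) (simp_all add: assms commutator_subgroup_mono)

lemma iter_commutator_subgroup_antimono:
  assumes "A \<lhd> G" "B \<lhd> G" "m \<le> n"
  shows "iter_commutator_subgroup G A n B \<subseteq> iter_commutator_subgroup G A m B"
proof (rule lift_Suc_antimono_le[OF _ assms(3)])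
  show "iter_commutator_subgroup G A (Suc n) B \<subseteq> iter_commutator_subgroup G A n B" for n
    using assms
    by (simp add: commutator_subgroup_subset_normal iter_commutator_subgroup_normal
        normal_subset_carrier)
qed

text \<open>Every factor on the right of the Jacobi identity for $[a,b,z]$ lies in a conjugate
  of $[[A,C],B]$ or of $[A,[B,C]]$: the commutator $c = [a,b]$ may be taken in $A$ or in $B$
  as needed, because both are normal.\<close>

lemma three_subgroups:
  assumes A: "A \<lhd> G" and B: "B \<lhd> G" and C: "C \<lhd> G" and P: "P \<lhd> G"
    and 1: "commutator_subgroup G (commutator_subgroup G A C) B \<subseteq> P"
    and 2: "commutator_subgroup G A (commutator_subgroup G B C) \<subseteq> P"
  shows "commutator_subgroup G (commutator_subgroup G A B) C \<subseteq> P"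
proof -
  interpret P: normal P G by fact
  interpret A: normal A G by fact
  interpret B: normal B G by fact
  interpret C: normal C G by fact
  note AC_B = 1[unfolded commutator_subgroup_subset_iff[OF P.subgroup_axioms], rule_format]
  note A_BC = 2[unfolded commutator_subgroup_subset_iff[OF P.subgroup_axioms], rule_format]
  have main: "commutator G (commutator G a b) z \<in> P" if "a \<in> A" "b \<in> B" "z \<in> C" for a b z
  proof -
    define c u v where "c = commutator G a b" and "u = commutator G a z"
      and "v = commutator G b z"
    have carr [simp]: "a \<in> carrier G" "b \<in> carrier G" "z \<in> carrier G"
      using that by auto
    have carr' [simp]: "c \<in> carrier G" "u \<in> carrier G" "v \<in> carrier G"
      by (simp_all add: c_def u_def v_def)
    have c: "c \<in> A" "c \<in> B"
      using that A B by (auto simp: c_def intro: commutator_in_normal)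
    have u: "u \<in> commutator_subgroup G A C"
      and v: "v \<in> commutator_subgroup G B C"
      using that by (auto simp: u_def v_def intro: commutator_in_commutator_subgroup)
    have "v \<in> B"
      using that B by (auto simp: v_def intro: commutator_in_normal)
    then have "commutator G a v \<in> P" "commutator G c v \<in> P"
      "commutator G u v \<in> P" "commutator G u b \<in> P" "commutator G u c \<in> P"
      using that c u v by (auto intro: AC_B A_BC)
    moreover from this have "commutator G c u \<in> P"
      using P.m_inv_closed inv_commutator[of u c] by fastforce
    ultimately have "inv c \<otimes> (inv u \<otimes> commutator G a v \<otimes> u) \<otimes> c \<otimes> commutator G c u
      \<otimes> (inv u \<otimes> commutator G c v \<otimes> u) \<otimes> commutator G u v \<otimes> (inv v \<otimes> commutator G u b \<otimes> v) \<in> P"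
      by (intro P.m_closed P.inv_op_closed1) auto
    then show ?thesis
      using commutator_jacobi[of a b z] by (simp add: c_def u_def v_def)
  qed
  have "commutator_subgroup G A B \<subseteq> centralizer_mod P C"
    using main
    by (subst commutator_subgroup_subset_iff[OF subgroup_centralizer_mod[OF P C.subset]])
      (auto simp: centralizer_mod_def)
  then show ?thesis
    by (auto simp: commutator_subgroup_subset_iff[OF P.subgroup_axioms] centralizer_mod_def)
qed

text \<open>A Leibniz rule: by the three subgroups lemma, taking commutators with $G$ acts on $[A,B]$
  like a derivation, so the $t$-fold commutator is spread over both factors in all possible ways.
  The induction lifts $P$ to the preimage of the centre of $G/P$, which absorbs one commutator
  with $G$ at a time.\<close>

lemma iter_commutator_subgroup_leibniz:
  assumes A: "A \<lhd> G" and B: "B \<lhd> G" and P: "P \<lhd> G"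
    and sub: "\<And>i j. i + j = t \<Longrightarrow>
      commutator_subgroup G (iter_commutator_subgroup G A i (carrier G))
        (iter_commutator_subgroup G B j (carrier G)) \<subseteq> P"
  shows "iter_commutator_subgroup G (commutator_subgroup G A B) t (carrier G) \<subseteq> P"
  using P sub
proof (induction t arbitrary: P)
  case 0
  then show ?case by (metis add_0 iter_commutator_subgroup.simps(1))
next
  case (Suc t)
  let ?I = "\<lambda>U i. iter_commutator_subgroup G U i (carrier G)"
  let ?Z = "centralizer_mod P (carrier G)"
  have le_Z: "U \<subseteq> ?Z" if "commutator_subgroup G U (carrier G) \<subseteq> P" "U \<subseteq> carrier G" for U
    using that by (auto simp: centralizer_mod_def
        commutator_subgroup_subset_iff[OF normal_imp_subgroup[OF Suc.prems(1)]])
  have "?I (commutator_subgroup G A B) t \<subseteq> ?Z"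
  proof (rule Suc.IH[OF normal_centralizer_mod_carrier[OF Suc.prems(1)]])
    fix i j :: nat assume ij: "i + j = t"
    have "commutator_subgroup G (commutator_subgroup G (?I A i) (?I B j)) (carrier G) \<subseteq> P"
      by (rule three_subgroups)
        (use Suc.prems(2)[of "Suc i" j] Suc.prems(2)[of i "Suc j"] ij in
          \<open>simp_all add: iter_commutator_subgroup_normal A B carrier_normal Suc.prems(1)\<close>)
    then show "commutator_subgroup G (?I A i) (?I B j) \<subseteq> ?Z"
      by (intro le_Z normal_subset_carrier commutator_subgroup_normal
          iter_commutator_subgroup_normal A B carrier_normal)
  qed
  then show ?case
    by (auto simp: centralizer_mod_def
        commutator_subgroup_subset_iff[OF normal_imp_subgroup[OF Suc.prems(1)]])
qed

section \<open>Lifting nilpotency from the quotient by the derived subgroup of a nilpotent subgroup\<close>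

text \<open>If $G$ acts nilpotently on $N/[N,N]$, then it acts nilpotently on every factor
  $\gamma_i(N)/\gamma_{i+1}(N)$: modulo $\gamma_{i+2}(N)$, a long commutator of
  $[\gamma_i(N), N]$ with $G$ spreads over the two factors, and one of them receives enough entries
  to drop into $\gamma_{i+1}(N)$ or into $[N,N]$.\<close>

lemma acts_nilpotently_on_lower_central_factors:
  assumes N: "N \<lhd> G"
    and k: "iter_commutator_subgroup G N k (carrier G) \<subseteq> commutator_subgroup G N N"
  shows "\<exists>m. iter_commutator_subgroup G (iter_commutator_subgroup G N i N) m (carrier G)
    \<subseteq> iter_commutator_subgroup G N (Suc i) N"
proof (induction i)
  case 0
  then show ?case using k by auto
next
  case (Suc i)
  let ?\<Gamma> = "\<lambda>i. iter_commutator_subgroup G N i N"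
  let ?I = "\<lambda>U i. iter_commutator_subgroup G U i (carrier G)"
  have \<Gamma>: "?\<Gamma> i \<lhd> G" for i
    by (intro iter_commutator_subgroup_normal N)
  obtain m where m: "?I (?\<Gamma> i) m \<subseteq> ?\<Gamma> (Suc i)"
    using Suc by auto
  \<comment> \<open>The case $[\gamma_{i+1}(N), \gamma_2(N)] \subseteq \gamma_{i+3}(N)$ of the usual inclusion, with
    $\gamma_{i+1}(N)$ written as \<open>?\<Gamma> i\<close>; the three subgroups lemma needs it in the other order.\<close>
  have NN: "commutator_subgroup G (?\<Gamma> i) (commutator_subgroup G N N) \<subseteq> ?\<Gamma> (Suc (Suc i))"
  proof -
    have comm: "commutator_subgroup G U V = commutator_subgroup G V U" if "U \<lhd> G" "V \<lhd> G" for U V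
      using that by (intro commutator_subgroup_commute normal_subset_carrier)
    have "commutator_subgroup G (commutator_subgroup G N N) (?\<Gamma> i) \<subseteq> ?\<Gamma> (Suc (Suc i))"
      by (rule three_subgroups[OF N N \<Gamma> \<Gamma>])
        (use comm[OF N \<Gamma>[of i]] comm[OF N \<Gamma>[of "Suc i"]] in simp_all)
    then show ?thesis
      using comm[OF \<Gamma>[of i] commutator_subgroup_normal[OF N N]] by simp
  qed
  have "?I (commutator_subgroup G (?\<Gamma> i) N) (m + k) \<subseteq> ?\<Gamma> (Suc (Suc i))"
  proof (rule iter_commutator_subgroup_leibniz[OF \<Gamma> N \<Gamma>])
    fix a b :: nat assume "a + b = m + k"
    then consider "m \<le> a" | "k \<le> b" by linarith
    then show "commutator_subgroup G (?I (?\<Gamma> i) a) (?I N b) \<subseteq> ?\<Gamma> (Suc (Suc i))"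
    proof cases
      case 1
      have "?I (?\<Gamma> i) a \<subseteq> ?\<Gamma> (Suc i)"
        using iter_commutator_subgroup_antimono[OF \<Gamma> carrier_normal 1] m by blast
      moreover have "?I N b \<subseteq> N"
        using iter_commutator_subgroup_antimono[OF N carrier_normal le0] by simp
      ultimately show ?thesis
        by (metis commutator_subgroup_mono iter_commutator_subgroup.simps(2))
    next
      case 2
      have "?I N b \<subseteq> commutator_subgroup G N N"
        using iter_commutator_subgroup_antimono[OF N carrier_normal 2] k by blast
      moreover have "?I (?\<Gamma> i) a \<subseteq> ?\<Gamma> i"
        using iter_commutator_subgroup_antimono[OF \<Gamma> carrier_normal le0] by simp
      ultimately show ?thesis
        using NN commutator_subgroup_mono by blast
    qed
  qed
  then show ?case by auto
qed

lemma acts_nilpotently_on_lower_central: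
  assumes N: "N \<lhd> G"
    and k: "iter_commutator_subgroup G N k (carrier G) \<subseteq> commutator_subgroup G N N"
  shows "\<exists>m. iter_commutator_subgroup G N m (carrier G) \<subseteq> iter_commutator_subgroup G N i N"
proof (induction i)
  case 0
  then show ?case by (intro exI[of _ 0]) simp
next
  case (Suc i)
  then obtain m where m: "iter_commutator_subgroup G N m (carrier G)
      \<subseteq> iter_commutator_subgroup G N i N"
    by blast
  obtain l where l: "iter_commutator_subgroup G (iter_commutator_subgroup G N i N) l (carrier G)
      \<subseteq> iter_commutator_subgroup G N (Suc i) N"
    using acts_nilpotently_on_lower_central_factors[OF N k] by blast
  have "iter_commutator_subgroup G N (m + l) (carrier G)
      \<subseteq> iter_commutator_subgroup G (iter_commutator_subgroup G N i N) l (carrier G)"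
    unfolding iter_commutator_subgroup_add by (rule iter_commutator_subgroup_mono[OF m])
  with l show ?case by blast
qed

lemma iter_commutator_subgroup_eq_lower_central:
  assumes "N \<lhd> G"
  shows "iter_commutator_subgroup G N n N = lower_central (G\<lparr>carrier := N\<rparr>) n"
proof (induction n)
  case (Suc n)
  interpret N: normal N G by fact
  let ?\<Gamma> = "iter_commutator_subgroup G N n N"
  have \<Gamma>: "?\<Gamma> \<subseteq> N"
    using iter_commutator_subgroup_antimono[OF assms assms le0] by simp
  have *: "commutator (G\<lparr>carrier := N\<rparr>) x y = commutator G x y" if "x \<in> ?\<Gamma>" "y \<in> N" for x y
    using that \<Gamma> by (auto simp: commutator_def m_inv_consistent[OF N.subgroup_axioms])
  have "{commutator (G\<lparr>carrier := N\<rparr>) x y |x y. x \<in> ?\<Gamma> \<and> y \<in> N}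
      = {commutator G x y |x y. x \<in> ?\<Gamma> \<and> y \<in> N}"
    using * by (metis (no_types, lifting))
  moreover have "{commutator G x y |x y. x \<in> ?\<Gamma> \<and> y \<in> N} \<subseteq> N"
    using \<Gamma> assms by (auto intro!: commutator_in_normal)
  ultimately show ?case
    by (simp add: commutator_subgroup_def generate_consistent[OF _ N.subgroup_axioms]
        flip: Suc.IH)
qed simp

lemma nilpotent_if_lower_central_subset:
  assumes "lower_central G n \<subseteq> {\<one>}"
  shows "nilpotent G"
proof -
  have "subgroup (lower_central G n) G"
    unfolding lower_central_eq_iter_commutator_subgroup
    by (intro normal_imp_subgroup iter_commutator_subgroup_normal carrier_normal)
  with assms have "lower_central G n = {\<one>}"
    using subgroup.one_closed by blast
  then show ?thesis by (auto simp: nilpotent_def)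
qed

text \<open>The case of Hall's nilpotency criterion in which $N$ contains $G'$: since $G' \subseteq N$,
  the lower central series of $G$ runs one step ahead of the series $[N, G, \dots, G]$.\<close>

lemma nilpotent_if_quotient_by_derived_nilpotent:
  assumes N: "N \<lhd> G" and nil: "nilpotent (G\<lparr>carrier := N\<rparr>)"
    and derived: "commutator_subgroup G (carrier G) (carrier G) \<subseteq> N"
    and k: "lower_central G k \<subseteq> commutator_subgroup G N N"
  shows "nilpotent G"
proof -
  have "iter_commutator_subgroup G N k (carrier G) \<subseteq> commutator_subgroup G N N"
    using iter_commutator_subgroup_mono[OF normal_subset_carrier[OF N]] k
    unfolding lower_central_eq_iter_commutator_subgroup by blast
  moreover obtain c where "iter_commutator_subgroup G N c N = {\<one>}"
    using nil by (auto simp: nilpotent_def iter_commutator_subgroup_eq_lower_central[OF N])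
  ultimately obtain m where m: "iter_commutator_subgroup G N m (carrier G) \<subseteq> {\<one>}"
    using acts_nilpotently_on_lower_central[OF N] by metis
  have "lower_central G (1 + m) \<subseteq> iter_commutator_subgroup G N m (carrier G)"
    unfolding lower_central_eq_iter_commutator_subgroup iter_commutator_subgroup_add
    using derived by (intro iter_commutator_subgroup_mono) simp
  with m show ?thesis
    by (intro nilpotent_if_lower_central_subset[of "1 + m"]) blast
qed

end

section \<open>Groups with an abelian subgroup that contains all commutators\<close>

text \<open>In such a group, $a \mapsto [a,g]$ is an endomorphism of $A$ for each $g$, and these
  endomorphisms commute with each other. They generate a commutative ring acting on $A$, which
  here is handled through left-normed commutators \<open>foldl (commutator G) a ws\<close>,
  the words in these endomorphisms.\<close>

locale abelian_over_derived = group G for G (structure) +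
  fixes A :: "'a set"
  assumes subgroup_A: "subgroup A G"
    and A_commute: "\<lbrakk>a \<in> A; b \<in> A\<rbrakk> \<Longrightarrow> a \<otimes> b = b \<otimes> a"
    and commutator_in_A: "\<lbrakk>x \<in> carrier G; y \<in> carrier G\<rbrakk> \<Longrightarrow> commutator G x y \<in> A"
begin

lemma A_carrier [simp]: "a \<in> A \<Longrightarrow> a \<in> carrier G"
  using subgroup.mem_carrier[OF subgroup_A] .

lemma A_commutator_trivial: "\<lbrakk>a \<in> A; b \<in> A\<rbrakk> \<Longrightarrow> commutator G a b = \<one>"
  by (simp add: commutator_eq_one_iff A_commute)

lemma A_conj_trivial: "\<lbrakk>a \<in> A; b \<in> A\<rbrakk> \<Longrightarrow> inv b \<otimes> a \<otimes> b = a"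
  using A_commute[of a b] by (simp add: group_word)

text \<open>Of the factors in \<open>commutator_jacobi\<close>, those that pair two elements of $A$ are trivial,
  and conjugation by elements of $A$ does not change the others.\<close>

lemma commutator_jacobi_abelian:
  assumes "x \<in> carrier G" "y \<in> carrier G" "z \<in> carrier G"
  shows "commutator G (commutator G x y) z =
    commutator G x (commutator G y z) \<otimes> commutator G (commutator G x z) y"
proof -
  have "commutator G x y \<in> A" "commutator G x z \<in> A" "commutator G y z \<in> A"
    "commutator G x (commutator G y z) \<in> A" "commutator G (commutator G x z) y \<in> A"
    using assms by (auto intro!: commutator_in_A)
  then show ?thesis
    using commutator_jacobi[OF assms] by (simp add: A_conj_trivial A_commutator_trivial)
qed

text \<open>The Jacobi identity for $a$, $g$, $h$, in which $[a,[g,h]]$ vanishes since both $a$ and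
  $[g,h]$ lie in $A$.\<close>

lemma commutator_swap:
  assumes "a \<in> A" "g \<in> carrier G" "h \<in> carrier G"
  shows "commutator G (commutator G a g) h = commutator G (commutator G a h) g"
  using assms commutator_jacobi_abelian[of a g h]
  by (simp add: A_commutator_trivial commutator_in_A)

lemma commutator_mult_A:
  "\<lbrakk>a \<in> A; b \<in> A; g \<in> carrier G\<rbrakk> \<Longrightarrow>
    commutator G (a \<otimes> b) g = commutator G a g \<otimes> commutator G b g"
  by (simp add: commutator_mult_left A_conj_trivial commutator_in_A)

lemma foldl_commutator_in_A:
  "\<lbrakk>a \<in> A; set ws \<subseteq> carrier G\<rbrakk> \<Longrightarrow> foldl (commutator G) a ws \<in> A"
  by (induction ws arbitrary: a) (auto simp: commutator_in_A)

lemma foldl_commutator_mult: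
  "\<lbrakk>a \<in> A; b \<in> A; set ws \<subseteq> carrier G\<rbrakk> \<Longrightarrow> foldl (commutator G) (a \<otimes> b) ws =
    foldl (commutator G) a ws \<otimes> foldl (commutator G) b ws"
  by (induction ws arbitrary: a b) (auto simp: commutator_mult_A commutator_in_A)

lemma foldl_commutator_swap:
  "\<lbrakk>a \<in> A; g \<in> carrier G; set ws \<subseteq> carrier G\<rbrakk> \<Longrightarrow>
    foldl (commutator G) (commutator G a g) ws = commutator G (foldl (commutator G) a ws) g"
  by (induction ws arbitrary: a) (auto simp: commutator_in_A commutator_swap)

lemma foldl_commutator_one: "set ws \<subseteq> carrier G \<Longrightarrow> foldl (commutator G) \<one> ws = \<one>"
  by (induction ws) auto

lemma foldl_commutator_kernel_subgroup:
  assumes "set ws \<subseteq> carrier G"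
  shows "subgroup {a \<in> A. foldl (commutator G) a ws = \<one>} G"
proof -
  have one: "\<one> \<in> A"
    using subgroup_A by (rule subgroup.one_closed)
  have inv: "foldl (commutator G) (inv a) ws = \<one>"
    if "a \<in> A" "foldl (commutator G) a ws = \<one>" for a
  proof -
    have "inv a \<in> A"
      using subgroup_A that by (simp add: subgroup.m_inv_closed)
    then show ?thesis
      using foldl_commutator_mult[of "inv a" a ws] foldl_commutator_in_A[of "inv a" ws]
        foldl_commutator_one[OF assms] that assms by simp
  qed
  show ?thesis
    by (rule subgroupI)
      (use one inv assms subgroup_A in \<open>auto simp: foldl_commutator_mult foldl_commutator_one
        intro: subgroup.m_closed subgroup.m_inv_closed\<close>)
qed

lemma iter_commutator_swap:
  "\<lbrakk>a \<in> A; y \<in> carrier G; g \<in> carrier G\<rbrakk> \<Longrightarrow>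
    iter_commutator G (commutator G a g) n y = commutator G (iter_commutator G a n y) g"
  by (simp add: iter_commutator_eq_foldl foldl_commutator_swap set_replicate_conv_if)

text \<open>As the entries of a word can be permuted, all occurrences of $s$ can be moved to the
  front.\<close>

lemma foldl_commutator_collect:
  assumes "s \<in> carrier G" "set ws \<subseteq> carrier G" "a \<in> A"
  shows "foldl (commutator G) a ws =
    foldl (commutator G) (iter_commutator G a (count_list ws s) s) (filter (\<lambda>w. w \<noteq> s) ws)"
  using assms(2,3)
proof (induction ws arbitrary: a)
  case (Cons w ws)
  then have IH: "foldl (commutator G) (commutator G a w) ws =
      foldl (commutator G) (iter_commutator G (commutator G a w) (count_list ws s) s)
        (filter (\<lambda>w. w \<noteq> s) ws)"
    by (simp add: commutator_in_A)
  show ?case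
  proof (cases "w = s")
    case True
    with IH show ?thesis
      by (simp flip: iter_commutator_Suc_left del: iter_commutator.simps)
  next
    case False
    with IH Cons.prems assms(1) show ?thesis
      by (simp add: iter_commutator_swap)
  qed
qed simp

text \<open>Pigeonhole: a long word in the generators contains one of them more than $n$ times.\<close>

lemma foldl_commutator_long_word:
  assumes "finite S" "S \<subseteq> carrier G" "a \<in> A"
    and n: "\<And>s. s \<in> S \<Longrightarrow> iter_commutator G a n s = \<one>"
    and ws: "set ws \<subseteq> S" "length ws = Suc (card S * n)"
  shows "foldl (commutator G) a ws = \<one>"
proof -
  have "\<exists>s\<in>S. n < count_list ws s"
  proof (rule ccontr)
    assume "\<not> ?thesis"
    then have "sum (count_list ws) S \<le> card S * n"
      using sum_bounded_above[of S "count_list ws" n] by (auto simp: not_less)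
    then show False
      using sum_count_set[OF ws(1) assms(1)] ws(2) by simp
  qed
  then obtain s where s: "s \<in> S" "n \<le> count_list ws s"
    by auto
  then have "iter_commutator G a (count_list ws s) s = \<one>"
    using iter_commutator_le[OF n] assms(2) by blast
  moreover have "set (filter (\<lambda>w. w \<noteq> s) ws) \<subseteq> carrier G"
    using ws(1) assms(2) by auto
  ultimately show ?thesis
    using foldl_commutator_collect[of s ws a] foldl_commutator_one s ws(1) assms(2,3)
    by (metis subset_iff)
qed

text \<open>The last entry of a word in generators may be replaced by any element of $G$, since the rest
  of the word commutes with all generators and so is central; the other entries follow because
  entries can be permuted.\<close>

lemma foldl_commutator_generators:
  assumes S: "S \<subseteq> carrier G" "generate G S = carrier G" and a: "a \<in> A"
    and triv: "\<And>ws. \<lbrakk>set ws \<subseteq> S; length ws = t\<rbrakk> \<Longrightarrow> foldl (commutator G) a ws = \<one>"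
    and ws: "set ws \<subseteq> carrier G" "length ws = t"
  shows "foldl (commutator G) a ws = \<one>"
  using a triv ws
proof (induction t arbitrary: a ws)
  case 0
  then show ?case by simp
next
  case (Suc t)
  obtain g us where g: "ws = g # us" "g \<in> carrier G" "set us \<subseteq> carrier G" "length us = t"
    using Suc.prems(3,4) by (cases ws) auto
  have "foldl (commutator G) (commutator G a g) us = \<one>"
  proof (rule Suc.IH)
    fix vs assume vs: "set vs \<subseteq> S" "length vs = t"
    let ?z = "foldl (commutator G) a vs"
    have "?z \<in> carrier G"
      using vs S Suc.prems(1) foldl_commutator_in_A by auto
    moreover have "commutator G ?z s = \<one>" if "s \<in> S" for s
      using Suc.prems(2)[of "vs @ [s]"] vs that by simp
    ultimately have "commutator G ?z g = \<one>"
      using commutator_trivial_if_generators S g by blast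
    then show "foldl (commutator G) (commutator G a g) vs = \<one>"
      using foldl_commutator_swap Suc.prems(1) g vs S by auto
  qed (use g Suc.prems in \<open>auto simp: commutator_in_A\<close>)
  with g show ?case by simp
qed

lemma derived_subset_A: "lower_central G (Suc 0) \<subseteq> A"
  unfolding lower_central.simps
  by (rule generate_subgroup_incl[OF _ subgroup_A]) (auto simp: commutator_in_A)

text \<open>Each step down the lower central series uses up one entry of the words that kill the
  derived subgroup. At $i = t$ only the empty word remains, so that term is trivial.\<close>

lemma lower_central_annihilated:
  assumes triv: "\<And>a ws. \<lbrakk>a \<in> lower_central G (Suc 0); set ws \<subseteq> carrier G; length ws = t\<rbrakk> \<Longrightarrow>
      foldl (commutator G) a ws = \<one>"
    and "i \<le> t" and ws: "set ws \<subseteq> carrier G" "length ws = t - i"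
    and a: "a \<in> lower_central G (Suc i)"
  shows "a \<in> A \<and> foldl (commutator G) a ws = \<one>"
  using assms(2) ws a
proof (induction i arbitrary: ws a)
  case 0
  then show ?case
    using derived_subset_A triv[OF _ 0(2)] by (auto simp del: lower_central.simps)
next
  case (Suc i)
  have "lower_central G (Suc (Suc i)) \<subseteq> {a \<in> A. foldl (commutator G) a ws = \<one>}"
    unfolding lower_central.simps(2)[of G "Suc i"]
  proof (rule generate_subgroup_incl[OF _ foldl_commutator_kernel_subgroup[OF Suc.prems(2)]], safe)
    fix x y assume x: "x \<in> lower_central G (Suc i)" and y: "y \<in> carrier G"
    have "x \<in> A \<and> foldl (commutator G) x (y # ws) = \<one>"
      using Suc.prems(1-3) y by (intro Suc.IH x) auto
    then show "commutator G x y \<in> A" "foldl (commutator G) (commutator G x y) ws = \<one>"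
      using y by (auto simp: commutator_in_A)
  qed
  with Suc.prems(4) show ?case by blast
qed

text \<open>The elements of $A$ killed by a fixed power of $[\cdot, s]$, for a generator $s$, form a
  normal subgroup of $G$. For exponent $n+1$, where $n$ is an Engel exponent, the Jacobi identity
  puts the commutators of the generators in it: applying $[\cdot, s]$ a further $n$ times to
  $[x,y,s] = [x,[y,s]]\,[x,s,y]$ kills both factors, because it kills $[x,s]$ and $[y,s]$. So this
  subgroup contains $G'$.\<close>

lemma engel_on_derived:
  assumes S: "S \<subseteq> carrier G" "generate G S = carrier G"
    and n: "\<And>x y. \<lbrakk>x \<in> S; y \<in> S\<rbrakk> \<Longrightarrow> iter_commutator G x n y = \<one>"
    and a: "a \<in> lower_central G (Suc 0)" and s: "s \<in> S"
  shows "a \<in> A \<and> iter_commutator G a (Suc n) s = \<one>"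
proof -
  define E where "E = {a \<in> A. foldl (commutator G) a (replicate (Suc n) s) = \<one>}"
  have sG: "s \<in> carrier G" "set (replicate (Suc n) s) \<subseteq> carrier G"
    using S s by auto
  have E_iff: "a \<in> E \<longleftrightarrow> a \<in> A \<and> iter_commutator G a (Suc n) s = \<one>" for a
    unfolding E_def iter_commutator_eq_foldl by simp
  have "subgroup E G"
    unfolding E_def by (rule foldl_commutator_kernel_subgroup[OF sG(2)])
  then have E: "E \<lhd> G"
  proof (rule subgroup_normal_if_commutator_closed)
    fix x g assume "x \<in> E" "g \<in> carrier G"
    then show "commutator G x g \<in> E"
      unfolding E_iff
      using iter_commutator_swap[of x s g "Suc n"] sG(1) by (simp add: commutator_in_A)
  qed
  have gen: "commutator G x y \<in> E" if "x \<in> S" "y \<in> S" for x y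
  proof -
    have carr: "x \<in> carrier G" "y \<in> carrier G"
      using that S by auto
    let ?u = "commutator G x s" and ?v = "commutator G y s"
    have uv: "?u \<in> A" "?v \<in> A" "?u \<in> carrier G" "?v \<in> carrier G"
      using carr sG by (auto simp: commutator_in_A)
    have kill: "iter_commutator G ?u n s = \<one>" "iter_commutator G ?v n s = \<one>"
      using iter_commutator_le[OF n, of _ _ "Suc n"] that s sG
      by (auto simp flip: iter_commutator_Suc_left simp del: iter_commutator.simps)
    have "iter_commutator G (commutator G ?u y) n s = \<one>"
      using kill uv carr sG by (simp add: iter_commutator_swap)
    moreover have "iter_commutator G (commutator G x ?v) n s = \<one>"
    proof -
      have "iter_commutator G (commutator G ?v x) n s = \<one>"
        using kill uv carr sG by (simp add: iter_commutator_swap)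
      then have "commutator G ?v x \<in> {a \<in> A. foldl (commutator G) a (replicate n s) = \<one>}"
        using uv carr by (simp add: iter_commutator_eq_foldl commutator_in_A)
      then have "inv (commutator G ?v x) \<in> {a \<in> A. foldl (commutator G) a (replicate n s) = \<one>}"
        using sG by (intro subgroup.m_inv_closed[OF foldl_commutator_kernel_subgroup])
          (auto simp: set_replicate_conv_if)
      then show ?thesis
        using uv carr by (simp add: inv_commutator iter_commutator_eq_foldl)
    qed
    ultimately have "iter_commutator G (commutator G (commutator G x y) s) n s = \<one>"
      using uv carr sG commutator_jacobi_abelian[OF carr sG(1)]
      by (simp add: iter_commutator_eq_foldl foldl_commutator_mult commutator_in_A
          set_replicate_conv_if)
    then show ?thesis
      unfolding E_iff iter_commutator_Suc_left using carr by (simp add: commutator_in_A)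
  qed
  have "lower_central G (Suc 0) \<subseteq> E"
    unfolding lower_central.simps
    using commutator_generate_in_normal[OF E S(1) S(1) gen] S(2)
    by (intro generate_subgroup_incl \<open>subgroup E G\<close>) auto
  with a show ?thesis
    by (auto simp: E_iff simp del: iter_commutator.simps)
qed

lemma nilpotent_if_generated_by_finite_engel_set:
  assumes S: "finite S" "engel_set G S" "generate G S = carrier G"
  shows "nilpotent G"
proof -
  have SG: "S \<subseteq> carrier G"
    and "\<forall>p\<in>S \<times> S. \<exists>n. iter_commutator G (fst p) n (snd p) = \<one>"
    using S(2) by (auto simp: engel_set_def)
  then obtain f where f: "\<And>p. p \<in> S \<times> S \<Longrightarrow> iter_commutator G (fst p) (f p) (snd p) = \<one>"
    by metis
  define n where "n = Max (f ` (S \<times> S))"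
  have n: "iter_commutator G x n y = \<one>" if "x \<in> S" "y \<in> S" for x y
  proof (rule iter_commutator_le)
    show "iter_commutator G x (f (x, y)) y = \<one>"
      using f[of "(x, y)"] that by simp
    show "f (x, y) \<le> n"
      using that S(1) by (auto simp: n_def intro!: Max_ge)
  qed (use that SG in auto)
  \<comment> \<open>\<open>engel_on_derived\<close> raises the Engel exponent on the derived subgroup to \<open>Suc n\<close>.\<close>
  define t where "t = Suc (card S * Suc n)"
  have "foldl (commutator G) a ws = \<one>"
    if "a \<in> lower_central G (Suc 0)" "set ws \<subseteq> carrier G" "length ws = t" for a ws
  proof (rule foldl_commutator_generators[OF SG S(3) _ _ that(2,3)])
    note a = engel_on_derived[OF SG S(3) n that(1)]
    show "a \<in> A"
      using that(1) derived_subset_A by blast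
    then show "foldl (commutator G) a vs = \<one>" if "set vs \<subseteq> S" "length vs = t" for vs
      using a that foldl_commutator_long_word[OF S(1) SG, of a "Suc n" vs] by (simp add: t_def)
  qed
  then have "lower_central G (Suc t) \<subseteq> {\<one>}"
    using lower_central_annihilated[of t t "[]"] by auto
  then show ?thesis
    by (rule nilpotent_if_lower_central_subset)
qed

end

section \<open>Passing to quotients\<close>

context group_hom
begin

lemma hom_commutator:
  "\<lbrakk>x \<in> carrier G; y \<in> carrier G\<rbrakk> \<Longrightarrow> h (commutator G x y) = commutator H (h x) (h y)"
  by (simp add: commutator_def)

lemma hom_iter_commutator:
  assumes "x \<in> carrier G" "y \<in> carrier G"
  shows "iter_commutator G x n y \<in> carrier G \<and>
    h (iter_commutator G x n y) = iter_commutator H (h x) n (h y)"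
  using assms by (induction n) (simp_all add: hom_commutator)

lemma engel_set_image:
  assumes "engel_set G S"
  shows "engel_set H (h ` S)"
  unfolding engel_set_def
proof (intro conjI ballI)
  show "h ` S \<subseteq> carrier H"
    using assms by (auto simp: engel_set_def)
  fix x' y' assume "x' \<in> h ` S" "y' \<in> h ` S"
  then obtain x y where xy: "x \<in> S" "y \<in> S" "x' = h x" "y' = h y"
    by auto
  then have carr: "x \<in> carrier G" "y \<in> carrier G"
    using assms by (auto simp: engel_set_def)
  obtain n where n: "iter_commutator G x n y = \<one>\<^bsub>G\<^esub>"
    using assms xy unfolding engel_set_def by blast
  have "iter_commutator H x' n y' = \<one>\<^bsub>H\<^esub>"
    using hom_iter_commutator[OF carr, of n] n xy by simp
  then show "\<exists>n. iter_commutator H x' n y' = \<one>\<^bsub>H\<^esub>" ..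
qed

lemma lower_central_image:
  "lower_central G n \<subseteq> carrier G \<and> h ` lower_central G n \<subseteq> lower_central H n"
proof (induction n)
  case (Suc n)
  let ?U = "{commutator G x y |x y. x \<in> lower_central G n \<and> y \<in> carrier G}"
  have U: "?U \<subseteq> carrier G"
    using Suc by auto
  have "h ` ?U \<subseteq> {commutator H x y |x y. x \<in> lower_central H n \<and> y \<in> carrier H}"
    using Suc by (force simp: hom_commutator)
  then have "generate H (h ` ?U) \<subseteq> lower_central H (Suc n)"
    by (simp add: H.mono_generate)
  with U show ?case
    by (simp add: generate_img G.generate_incl)
qed auto

end

lemma (in normal) group_hom_Mod: "group_hom G (G Mod H) (\<lambda>a. H #> a)"
  by (intro group_hom.intro group_hom_axioms.intro is_group factorgroup_is_group r_coset_hom_Mod)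

lemma (in normal) coset_commute_iff:
  assumes "x \<in> carrier G" "y \<in> carrier G"
  shows "(H #> x) \<otimes>\<^bsub>G Mod H\<^esub> (H #> y) = (H #> y) \<otimes>\<^bsub>G Mod H\<^esub> (H #> x) \<longleftrightarrow> commutator G x y \<in> H"
proof -
  interpret h: group_hom G "G Mod H" "\<lambda>a. H #> a"
    by (rule group_hom_Mod)
  have "H #> commutator G x y = H \<longleftrightarrow> commutator G x y \<in> H"
    using assms coset_join1[OF _ _ subgroup_axioms] coset_join2[OF _ subgroup_axioms] by blast
  then show ?thesis
    using assms h.hom_commutator[OF assms]
    by (simp add: h.H.commutator_eq_one_iff[symmetric] del: mult_FactGroup)
qed

theorem theorem2p3:
  fixes G :: "('a, 'b) monoid_scheme" and S :: "'a set"
  assumes "group G"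
    and "nilpotent_by_abelian G"
    and "finite S"
    and "engel_set G S"
    and "generate G S = carrier G"
  shows "nilpotent G"
proof -
  interpret group G by fact
  obtain N where N: "N \<lhd> G" and nil: "nilpotent (G\<lparr>carrier := N\<rparr>)" and ab: "comm_group (G Mod N)"
    using assms(2) by (auto simp: nilpotent_by_abelian_def)
  interpret N: normal N G by fact
  interpret ab: comm_group "G Mod N" by fact
  interpret hN: group_hom G "G Mod N" "\<lambda>a. N #>\<^bsub>G\<^esub> a"
    by (rule N.group_hom_Mod)
  have G_N: "commutator G x y \<in> N" if "x \<in> carrier G" "y \<in> carrier G" for x y
    using N.coset_commute_iff[OF that] ab.m_comm hN.hom_closed that by blast
  define L where "L = commutator_subgroup G N N"
  have L: "L \<lhd> G"
    unfolding L_def by (rule commutator_subgroup_normal[OF N N])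
  interpret L: normal L G by fact
  let ?h = "\<lambda>a. L #>\<^bsub>G\<^esub> a"
  interpret h: group_hom G "G Mod L" ?h
    by (rule L.group_hom_Mod)
  have img: "?h ` carrier G = carrier (G Mod L)"
    by (auto simp: FactGroup_def RCOSETS_def)
  interpret Q: abelian_over_derived "G Mod L" "?h ` N"
  proof (rule abelian_over_derived.intro[OF h.H.is_group abelian_over_derived_axioms.intro])
    show "subgroup (?h ` N) (G Mod L)"
      by (rule h.subgroup_img_is_subgroup[OF N.subgroup_axioms])
    show "a \<otimes>\<^bsub>G Mod L\<^esub> b = b \<otimes>\<^bsub>G Mod L\<^esub> a" if ab: "a \<in> ?h ` N" "b \<in> ?h ` N" for a b
    proof -
      obtain x y where xy: "x \<in> N" "y \<in> N" "a = ?h x" "b = ?h y"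
        using ab by (elim imageE)
      have "commutator G x y \<in> L"
        unfolding L_def using xy(1,2) by (rule commutator_in_commutator_subgroup)
      then show ?thesis
        unfolding xy(3,4) L.coset_commute_iff[OF N.mem_carrier[OF xy(1)] N.mem_carrier[OF xy(2)]] .
    qed
    show "commutator (G Mod L) x y \<in> ?h ` N"
      if "x \<in> carrier (G Mod L)" "y \<in> carrier (G Mod L)" for x y
      using that G_N unfolding img[symmetric] by (auto simp flip: h.hom_commutator)
  qed
  have "nilpotent (G Mod L)"
  proof (rule Q.nilpotent_if_generated_by_finite_engel_set)
    have "S \<subseteq> carrier G"
      using assms(4) by (simp add: engel_set_def)
    then show "generate (G Mod L) (?h ` S) = carrier (G Mod L)"
      using h.generate_img assms(5) img by simp
  qed (use assms(3,4) h.engel_set_image in auto)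
  then obtain k where k: "lower_central (G Mod L) k = {\<one>\<^bsub>G Mod L\<^esub>}"
    by (auto simp: nilpotent_def)
  have "lower_central G k \<subseteq> L"
  proof
    fix x assume "x \<in> lower_central G k"
    then have "x \<in> carrier G" "?h x = L"
      using h.lower_central_image[of k] k by auto
    then show "x \<in> L"
      using coset_join1 L.subgroup_axioms by blast
  qed
  moreover have "commutator_subgroup G (carrier G) (carrier G) \<subseteq> N"
    by (simp add: commutator_subgroup_subset_iff[OF N.subgroup_axioms] G_N)
  ultimately show ?thesis
    unfolding L_def by (intro nilpotent_if_quotient_by_derived_nilpotent[OF N nil])
qed

end
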